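(* For every $L\in\mathbf L^{\rm reg}$ and $M\in\mathbf L$ satisfying $$d_{\rm ABW}^2([L],[M])<\min_{t=1,\dots,T}\lambda_{\min}\big((L^\top L)_{t,t}\big),$$ there exists a unique (constant speed) geodesic between $[L]$ and $[M]$ in $(\mathbf L/_{\mathbf O},d_{\rm ABW})$.
   Context: Fix integers $d,T\ge 1$. Write matrices $A\in\mathbb R^{dT\times dT}$ in block form $A=(A_{s,t})_{s,t=1}^T$ with $A_{s,t}\in\mathbb R^{d\times d}$; $(AB)_{t,t}$ is the $t$-th diagonal block of $AB$. $\mathbf L$ is the set of block-lower-triangular matrices ($L_{t,s}=0$ for $s>t$). $\mathbf O=\{\mathrm{diag}(O_1,\dots,O_T): O_t\in\mathbb R^{d\times d}\text{ orthogonal}\}$. $\|\cdot\|_{\rm F}$ is the Frobenius norm. For $L,M\in\mathbf L$, $d_{\rm ABW}(L,M)=\min_{O\in\mathbf O}\|L-MO\|_{\rm F}$ (equal to the adapted Wasserstein distance between the Gaussian processes $LG$ and $MG$). $\mathbf L/_{\mathbf O}$ is the quotient by $L\sim M\iff L=MO$ for some $O\in\mathbf O$, with classes $[L]$ and the induced metric $d_{\rm ABW}$. $\mathbf L^{\rm reg}=\{L\in\mathbf L:(L^\top L)_{t,t}\text{ is positive definite for all }t=1,\dots,T\}$. For a symmetric matrix $A$, $\lambda_{\min}(A)$ is its smallest eigenvalue. A constant speed geodesic between $[L]$ and $[M]$ is a curve $\gamma:[0,1]\to\mathbf L/_{\mathbf O}$ with $\gamma(0)=[L]$, $\gamma(1)=[M]$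 and $d_{\rm ABW}(\gamma(u),\gamma(v))=|u-v|\,d_{\rm ABW}([L],[M])$ for all $u,v\in[0,1]$. *)

theory Defs
  imports "HOL-Analysis.Analysis"
begin

text \<open>
  A matrix in $\mathbb{R}^{dT\times dT}$ is indexed by pairs of a time (block) index in a finite
  linear order \<open>'t\<close>, with $T$ elements, and a coordinate index in a finite type \<open>'d\<close>,
  with $d$ elements; both index types are arbitrary.
\<close>

type_synonym ('t, 'd) block_matrix = "real^('t \<times> 'd)^('t \<times> 'd)"

definition block :: "('t::finite, 'd::finite) block_matrix \<Rightarrow> 't \<Rightarrow> 't \<Rightarrow> real^'d^'d" where
  "block A s t = (\<chi> i j. A $ (s, i) $ (t, j))"

definition block_diag :: "('t::finite \<Rightarrow> real^'d^'d) \<Rightarrow> ('t, 'd::finite) block_matrix" where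
  "block_diag B = (\<chi> p q. if fst p = fst q then B (fst p) $ snd p $ snd q else 0)"

definition block_lower :: "('t::{finite,linorder}, 'd::finite) block_matrix set" where
  "block_lower = {L. \<forall>t s. t < s \<longrightarrow> block L t s = 0}"

definition block_orth :: "('t::finite, 'd::finite) block_matrix set" where
  "block_orth = {block_diag B | B. \<forall>t. orthogonal_matrix (B t)}"

definition pos_def :: "real^'n^'n \<Rightarrow> bool" where
  "pos_def A \<longleftrightarrow> transpose A = A \<and> (\<forall>x. x \<noteq> 0 \<longrightarrow> 0 < x \<bullet> (A *v x))"

definition block_lower_reg :: "('t::{finite,linorder}, 'd::finite) block_matrix set" where
  "block_lower_reg = {L \<in> block_lower. \<forall>t. pos_def (block (transpose L ** L) t t)}"

definition eigenvalues :: "real^'n^'n \<Rightarrow> real set" where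
  "eigenvalues A = {c. \<exists>x. x \<noteq> 0 \<and> A *v x = c *\<^sub>R x}"

definition lambda_min :: "real^'n^'n \<Rightarrow> real" where
  "lambda_min A = Min (eigenvalues A)"

text \<open>The library norm on nested vectors is the Frobenius norm.\<close>

lemma norm_eq_frobenius:
  fixes A :: "real^'n^'m"
  shows "norm A = sqrt (\<Sum>i\<in>UNIV. \<Sum>j\<in>UNIV. (A $ i $ j)\<^sup>2)"
  by (simp add: norm_vec_def L2_set_def sum_nonneg)

text \<open>The infimum is attained, see \<open>d_ABW_attained\<close> below.\<close>

definition d_ABW :: "('t::{finite,linorder}, 'd::finite) block_matrix \<Rightarrow> ('t, 'd) block_matrix \<Rightarrow> real" where
  "d_ABW L M = (INF Q\<in>block_orth. norm (L - M ** Q))"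

definition orth_rel ::
  "(('t::{finite,linorder}, 'd::finite) block_matrix \<times> ('t, 'd) block_matrix) set" where
  "orth_rel = {(L, M). L \<in> block_lower \<and> M \<in> block_lower \<and> (\<exists>Q\<in>block_orth. L = M ** Q)}"

definition orth_class ::
  "('t::{finite,linorder}, 'd::finite) block_matrix \<Rightarrow> ('t, 'd) block_matrix set" where
  "orth_class L = orth_rel `` {L}"

definition lower_quot :: "('t::{finite,linorder}, 'd::finite) block_matrix set set" where
  "lower_quot = block_lower // orth_rel"

text \<open>The choice of representatives is irrelevant, see \<open>quot_d_ABW_orth_class\<close> below.\<close>

definition quot_d_ABW ::
  "('t::{finite,linorder}, 'd::finite) block_matrix set \<Rightarrow> ('t, 'd) block_matrix set \<Rightarrow> real" where
  "quot_d_ABW X Y = d_ABW (SOME L. L \<in> X) (SOME M. M \<in> Y)"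

text \<open>
  Curves are extensional functions on \<open>{0..1}\<close> (undefined outside), so that
  equality of curves is equality on $[0,1]$.
\<close>

definition const_speed_geodesic ::
  "'a set \<Rightarrow> ('a \<Rightarrow> 'a \<Rightarrow> real) \<Rightarrow> 'a \<Rightarrow> 'a \<Rightarrow> (real \<Rightarrow> 'a) \<Rightarrow> bool" where
  "const_speed_geodesic X dst x y \<gamma> \<longleftrightarrow>
     \<gamma> \<in> {0..1} \<rightarrow>\<^sub>E X \<and> \<gamma> 0 = x \<and> \<gamma> 1 = y \<and>
     (\<forall>u\<in>{0..1}. \<forall>v\<in>{0..1}. dst (\<gamma> u) (\<gamma> v) = \<bar>u - v\<bar> * dst x y)"


lemma sum_prod_UNIV:
  fixes f :: "'t::finite \<times> 'd::finite \<Rightarrow> 'a::comm_monoid_add"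
  shows "(\<Sum>p\<in>UNIV. f p) = (\<Sum>s\<in>UNIV. \<Sum>i\<in>UNIV. f (s, i))"
  unfolding UNIV_Times_UNIV[symmetric] by (simp add: sum.cartesian_product)

lemma block_diag_mult:
  fixes B C :: "'t::finite \<Rightarrow> real^'d^'d::finite"
  shows "block_diag B ** block_diag C = block_diag (\<lambda>t. B t ** C t)"
proof -
  have "(\<Sum>r\<in>UNIV. \<Sum>k\<in>UNIV. block_diag B $ (s, i) $ (r, k) * block_diag C $ (r, k) $ (t, j))
     = block_diag (\<lambda>t. B t ** C t) $ (s, i) $ (t, j)" for s t i j
  proof -
    have "(\<Sum>r\<in>UNIV. \<Sum>k\<in>UNIV. block_diag B $ (s, i) $ (r, k) * block_diag C $ (r, k) $ (t, j))
       = (\<Sum>r\<in>UNIV. if r = s then (\<Sum>k\<in>UNIV. B s $ i $ k * block_diag C $ (s, k) $ (t, j)) else 0)"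
      by (rule sum.cong) (auto simp: block_diag_def)
    also have "\<dots> = (\<Sum>k\<in>UNIV. B s $ i $ k * block_diag C $ (s, k) $ (t, j))"
      by simp
    also have "\<dots> = block_diag (\<lambda>t. B t ** C t) $ (s, i) $ (t, j)"
      by (simp add: block_diag_def matrix_matrix_mult_def)
    finally show ?thesis .
  qed
  then show ?thesis
    by (simp add: vec_eq_iff matrix_matrix_mult_def sum_prod_UNIV)
qed

lemma transpose_block_diag: "transpose (block_diag B) = block_diag (\<lambda>t. transpose (B t))"
  by (auto simp: vec_eq_iff transpose_def block_diag_def)

lemma block_diag_mat_1: "block_diag (\<lambda>t. mat 1) = mat 1"
  by (auto simp: vec_eq_iff mat_def block_diag_def prod_eq_iff)

lemma mat_1_in_block_orth: "mat 1 \<in> block_orth"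
  unfolding block_orth_def mem_Collect_eq
  by (intro exI[of _ "\<lambda>t. mat 1"]) (simp add: block_diag_mat_1 orthogonal_matrix_id)

lemma block_orth_mult: "P \<in> block_orth \<Longrightarrow> Q \<in> block_orth \<Longrightarrow> P ** Q \<in> block_orth"
  unfolding block_orth_def using orthogonal_matrix_mul by (fastforce simp: block_diag_mult)

lemma block_orth_transpose: "Q \<in> block_orth \<Longrightarrow> transpose Q \<in> block_orth"
  unfolding block_orth_def using orthogonal_matrix_transpose by (fastforce simp: transpose_block_diag)

lemma block_orth_orthogonal: "Q \<in> block_orth \<Longrightarrow> orthogonal_matrix Q"
  unfolding block_orth_def orthogonal_matrix_def
  by (auto simp: transpose_block_diag block_diag_mult block_diag_mat_1)

lemma norm_mult_orthogonal:
  fixes A Q :: "real^'n^'n"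
  assumes "orthogonal_matrix Q"
  shows "norm (A ** Q) = norm A"
proof -
  have "norm ((A ** Q) $ i) = norm (A $ i)" for i
  proof -
    have "(A ** Q) $ i = A $ i v* Q"
      by (simp add: vec_eq_iff matrix_matrix_mult_def vector_matrix_mult_def mult.commute)
    also have "\<dots> = transpose Q *v A $ i" by simp
    finally show ?thesis
      using assms orthogonal_transformation_matrix[of "(*v) (transpose Q)"]
      by (simp add: orthogonal_matrix_transpose orthogonal_transformation)
  qed
  then show ?thesis by (simp add: norm_vec_def)
qed

lemma diff_mult_distrib_matrix:
  fixes A B C :: "real^'n^'n"
  shows "(A - B) ** C = A ** C - B ** C"
  by (simp add: vec_eq_iff matrix_matrix_mult_def left_diff_distrib sum_subtractf)

lemma block_lower_mult_orth:
  assumes "L \<in> block_lower" "Q \<in> block_orth"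
  shows "L ** Q \<in> block_lower"
proof -
  obtain B where B: "Q = block_diag B" using assms by (auto simp: block_orth_def)
  have "(\<Sum>r\<in>UNIV. \<Sum>k\<in>UNIV. L $ (t, i) $ (r, k) * Q $ (r, k) $ (s, j)) = 0" if "t < s" for s t i j
  proof (intro sum.neutral ballI)
    fix r k
    show "L $ (t, i) $ (r, k) * Q $ (r, k) $ (s, j) = 0"
      using assms(1) that by (auto simp: B block_diag_def block_lower_def block_def vec_eq_iff)
  qed
  then show ?thesis
    by (simp add: block_lower_def block_def vec_eq_iff matrix_matrix_mult_def sum_prod_UNIV)
qed

lemma equiv_orth_rel:
  "equiv block_lower (orth_rel :: (('t::{finite,linorder}, 'd::finite) block_matrix \<times> _) set)"
proof (rule equivI)
  show "orth_rel \<subseteq> block_lower \<times> block_lower" by (auto simp: orth_rel_def)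
  show "refl_on block_lower orth_rel"
    unfolding refl_on_def orth_rel_def using mat_1_in_block_orth by (force intro: bexI[of _ "mat 1"])
  show "sym (orth_rel :: (('t, 'd) block_matrix \<times> _) set)"
  proof (rule symI)
    fix L M :: "('t, 'd) block_matrix" assume "(L, M) \<in> orth_rel"
    then obtain Q where Q: "L \<in> block_lower" "M \<in> block_lower" "Q \<in> block_orth" "L = M ** Q"
      by (auto simp: orth_rel_def)
    then have "M = L ** transpose Q"
      using block_orth_orthogonal[of Q]
      by (simp add: matrix_mul_assoc[symmetric] orthogonal_matrix_def)
    with Q show "(M, L) \<in> orth_rel"
      unfolding orth_rel_def using block_orth_transpose[OF Q(3)] by blast
  qed
  show "trans (orth_rel :: (('t, 'd) block_matrix \<times> _) set)"
  proof (rule transI)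
    fix L M N :: "('t, 'd) block_matrix" assume "(L, M) \<in> orth_rel" "(M, N) \<in> orth_rel"
    then obtain P Q where PQ: "L \<in> block_lower" "N \<in> block_lower" "P \<in> block_orth" "Q \<in> block_orth"
      "L = M ** P" "M = N ** Q" unfolding orth_rel_def by blast
    then have "L = N ** (Q ** P)" by (simp add: matrix_mul_assoc)
    with PQ show "(L, N) \<in> orth_rel"
      unfolding orth_rel_def using block_orth_mult[OF PQ(4) PQ(3)] by blast
  qed
qed

lemma compact_block_orth: "compact (block_orth :: ('t::finite, 'd::finite) block_matrix set)"
proof -
  have eq: "block_orth = {Q :: ('t, 'd) block_matrix. transpose Q ** Q = mat 1 \<and> Q ** transpose Q = mat 1
      \<and> (\<forall>s t i j. s \<noteq> t \<longrightarrow> Q $ (s, i) $ (t, j) = 0)}" (is "_ = ?S")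
  proof (intro subset_antisym subsetI)
    fix Q :: "('t, 'd) block_matrix" assume "Q \<in> block_orth"
    then show "Q \<in> ?S" using block_orth_orthogonal[of Q]
      by (auto simp: orthogonal_matrix_def block_orth_def block_diag_def)
  next
    fix Q :: "('t, 'd) block_matrix" assume Q: "Q \<in> ?S"
    define B where "B t = block Q t t" for t
    have QB: "Q = block_diag B"
      using Q by (auto simp: vec_eq_iff block_diag_def B_def block_def)
    have "block_diag (\<lambda>t. transpose (B t) ** B t) = block_diag (\<lambda>t. mat 1)"
         "block_diag (\<lambda>t. B t ** transpose (B t)) = block_diag (\<lambda>t. mat 1)"
      using Q unfolding QB by (auto simp: transpose_block_diag block_diag_mult block_diag_mat_1)
    then have "block (block_diag (\<lambda>t. transpose (B t) ** B t)) t t = block (block_diag (\<lambda>t. mat 1)) t t"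
         "block (block_diag (\<lambda>t. B t ** transpose (B t))) t t = block (block_diag (\<lambda>t. mat 1)) t t" for t
      by simp_all
    moreover have "block (block_diag C) t t = C t" for C :: "'t \<Rightarrow> real^'d^'d" and t
      by (simp add: vec_eq_iff block_def block_diag_def)
    ultimately have "orthogonal_matrix (B t)" for t
      by (simp add: orthogonal_matrix_def)
    then show "Q \<in> block_orth" using QB by (auto simp: block_orth_def)
  qed
  have cont: "continuous_on UNIV (\<lambda>Q::('t, 'd) block_matrix. transpose Q ** Q)"
             "continuous_on UNIV (\<lambda>Q::('t, 'd) block_matrix. Q ** transpose Q)"
    unfolding matrix_matrix_mult_def transpose_def vec_lambda_beta
    by (intro continuous_intros)+
  have "closed (block_orth :: ('t, 'd) block_matrix set)"
  proof -
    have "closed {Q :: ('t, 'd) block_matrix. transpose Q ** Q = mat 1}"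
         "closed {Q :: ('t, 'd) block_matrix. Q ** transpose Q = mat 1}"
      by (intro closed_Collect_eq cont continuous_on_const)+
    moreover have "closed {Q :: ('t, 'd) block_matrix. s \<noteq> t \<longrightarrow> Q $ (s, i) $ (t, j) = 0}" for s t i j
      by (cases "s = t") (auto intro!: closed_Collect_eq continuous_intros)
    ultimately show ?thesis
      unfolding eq by (intro closed_Collect_conj closed_Collect_all)
  qed
  moreover have "bounded (block_orth :: ('t, 'd) block_matrix set)"
    unfolding bounded_iff
  proof (intro exI ballI)
    fix Q :: "('t, 'd) block_matrix" assume "Q \<in> block_orth"
    then show "norm Q \<le> norm (mat 1 :: ('t, 'd) block_matrix)"
      using norm_mult_orthogonal[of Q "mat 1"] block_orth_orthogonal[of Q] by simp
  qed
  ultimately show ?thesis by (simp add: compact_eq_bounded_closed)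
qed

lemma d_ABW_attained:
  fixes L M :: "('t::{finite,linorder}, 'd::finite) block_matrix"
  shows "\<exists>Q\<in>block_orth. d_ABW L M = norm (L - M ** Q) \<and> (\<forall>P\<in>block_orth. norm (L - M ** Q) \<le> norm (L - M ** P))"
proof -
  have "continuous_on block_orth (\<lambda>Q. norm (L - M ** Q))"
    unfolding matrix_matrix_mult_def by (intro continuous_intros)
  then obtain Q where Q: "Q \<in> block_orth" "\<And>P. P \<in> block_orth \<Longrightarrow> norm (L - M ** Q) \<le> norm (L - M ** P)"
    using continuous_attains_inf[OF compact_block_orth] mat_1_in_block_orth by (metis empty_iff)
  then have "d_ABW L M = norm (L - M ** Q)"
    unfolding d_ABW_def by (intro cInf_eq_minimum) auto
  with Q show ?thesis by blast
qed

lemma d_ABW_mult_orth_le: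
  fixes L M :: "('t::{finite,linorder}, 'd::finite) block_matrix"
  assumes P: "P \<in> block_orth" and R: "R \<in> block_orth"
  shows "d_ABW (L ** P) (M ** R) \<le> d_ABW L M"
proof -
  obtain Q where Q: "Q \<in> block_orth" "d_ABW L M = norm (L - M ** Q)"
    using d_ABW_attained by blast
  define Q' where "Q' = transpose R ** (Q ** P)"
  have Q': "Q' \<in> block_orth"
    unfolding Q'_def using P R Q by (intro block_orth_mult block_orth_transpose)
  have "R ** transpose R = mat 1" using block_orth_orthogonal[OF R] by (simp add: orthogonal_matrix_def)
  then have "R ** Q' = Q ** P"
    by (simp add: Q'_def matrix_mul_assoc)
  then have "L ** P - (M ** R) ** Q' = (L - M ** Q) ** P"
    by (simp add: diff_mult_distrib_matrix matrix_mul_assoc[symmetric])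
  then have "norm (L ** P - (M ** R) ** Q') = d_ABW L M"
    using Q norm_mult_orthogonal block_orth_orthogonal[OF P] by metis
  then show ?thesis using d_ABW_attained[of "L ** P" "M ** R"] Q' by metis
qed

lemma d_ABW_cong:
  assumes "(L, L') \<in> orth_rel" "(M, M') \<in> orth_rel"
  shows "d_ABW L M = d_ABW L' M'"
proof (rule antisym)
  show "d_ABW L M \<le> d_ABW L' M'"
    using assms d_ABW_mult_orth_le by (fastforce simp: orth_rel_def)
  have "(L', L) \<in> orth_rel" "(M', M) \<in> orth_rel"
    using assms equiv_orth_rel by (auto simp: equiv_def dest: symD)
  then show "d_ABW L' M' \<le> d_ABW L M"
    using d_ABW_mult_orth_le by (fastforce simp: orth_rel_def)
qed

lemma quot_d_ABW_orth_class:
  assumes "L \<in> block_lower" "M \<in> block_lower"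
  shows "quot_d_ABW (orth_class L) (orth_class M) = d_ABW L M"
proof -
  have "(N, SOME N'. N' \<in> orth_class N) \<in> orth_rel" if "N \<in> block_lower"
    for N :: "('a, 'b) block_matrix"
    using someI[of "\<lambda>N'. N' \<in> orth_class N" N] equiv_class_self[OF equiv_orth_rel that]
    by (auto simp: orth_class_def)
  with assms show ?thesis unfolding quot_d_ABW_def by (metis d_ABW_cong)
qed

end

theory Submission
  imports Defs
begin

text \<open>
  Let \<open>M'\<close> be a representative of \<open>[M]\<close> closest to \<open>L\<close>. The triangle inequality makes
  \<open>u \<mapsto> [(1 - u) L + u M']\<close> a geodesic, and by strict convexity of the Frobenius norm every
  geodesic consists of points \<open>[(1 - u) L + u M'']\<close> with a closest representative \<open>M''\<close> that may
  depend on \<open>u\<close>. So it is enough that \<open>M'\<close> is unique. Being closest says that \<open>Q = 1\<close> maximizes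
  $\sum_t \mathrm{tr}(S_t^\top Q_t)$ over \<open>block_orth\<close>, where $S_t = (M'^\top L)_{t,t}$. This makes
  every $S_t$ symmetric, and the eigenvalue bound makes it positive definite; then
  $\mathrm{tr}((1 - Q_t) S_t (1 - Q_t)^\top) = 2\,\mathrm{tr}\,S_t - 2\,\mathrm{tr}(S_t Q_t)$
  vanishes only for $Q_t = 1$.
\<close>

section \<open>Matrix inner product\<close>

lemma inner_matrix: "A \<bullet> B = (\<Sum>i\<in>UNIV. \<Sum>j\<in>UNIV. A $ i $ j * B $ i $ j)"
  for A B :: "real^'n^'m"
  by (simp add: inner_vec_def)

text \<open>Left multiplication by \<open>A\<close> has left multiplication by
  \<open>transpose A\<close> as its adjoint. This makes the cross term of a squared distance a
  linear functional of the orthogonal factor.\<close>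

lemma inner_matrix_mult_left: "(A ** B) \<bullet> C = B \<bullet> (transpose A ** C)"
  for A :: "real^'n^'m" and B :: "real^'k^'n" and C :: "real^'k^'m"
proof -
  have "(A ** B) \<bullet> C = (\<Sum>i\<in>UNIV. \<Sum>j\<in>UNIV. \<Sum>k\<in>UNIV. A $ i $ k * B $ k $ j * C $ i $ j)"
    by (simp add: inner_matrix matrix_matrix_mult_def sum_distrib_right)
  also have "\<dots> = (\<Sum>i\<in>UNIV. \<Sum>k\<in>UNIV. \<Sum>j\<in>UNIV. A $ i $ k * B $ k $ j * C $ i $ j)"
    by (intro sum.cong refl sum.swap)
  also have "\<dots> = (\<Sum>k\<in>UNIV. \<Sum>i\<in>UNIV. \<Sum>j\<in>UNIV. A $ i $ k * B $ k $ j * C $ i $ j)"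
    by (rule sum.swap)
  also have "\<dots> = (\<Sum>k\<in>UNIV. \<Sum>j\<in>UNIV. \<Sum>i\<in>UNIV. A $ i $ k * B $ k $ j * C $ i $ j)"
    by (intro sum.cong refl sum.swap)
  also have "\<dots> = B \<bullet> (transpose A ** C)"
    by (simp add: inner_matrix matrix_matrix_mult_def transpose_def sum_distrib_left mult_ac)
  finally show ?thesis .
qed

lemma inner_transpose: "transpose A \<bullet> transpose B = A \<bullet> B"
  for A B :: "real^'n^'m"
  unfolding inner_matrix transpose_def by (simp add: sum.swap[of _ "UNIV :: 'n set"])

lemma inner_matrix_vector_mult: "x \<bullet> (A *v y) = (transpose A *v x) \<bullet> y"
  for A :: "real^'n^'m"
  by (simp add: dot_lmul_matrix)

text \<open>The Frobenius norm dominates the operator norm, by Cauchy-Schwarz in each row.\<close>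

lemma norm_matrix_vector_mult_le: "norm (A *v x) \<le> norm A * norm x"
  for A :: "real^'n^'m"
proof (rule power2_le_imp_le)
  have "(norm (A *v x))\<^sup>2 = (\<Sum>i\<in>UNIV. (A $ i \<bullet> x)\<^sup>2)"
    unfolding power2_norm_eq_inner
    by (simp add: inner_vec_def[of "A *v x"] matrix_vector_mul_component power2_eq_square)
  also have "\<dots> \<le> (\<Sum>i\<in>UNIV. (A $ i \<bullet> A $ i) * (x \<bullet> x))"
    by (intro sum_mono Cauchy_Schwarz_ineq)
  also have "\<dots> = (norm A * norm x)\<^sup>2"
    by (simp add: power_mult_distrib power2_norm_eq_inner inner_vec_def[of A] sum_distrib_right)
  finally show "(norm (A *v x))\<^sup>2 \<le> (norm A * norm x)\<^sup>2" .
qed simp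

lemma transpose_diff: "transpose (A - B) = transpose A - transpose B"
  for A B :: "real^'n^'m"
  by (simp add: vec_eq_iff transpose_def)

lemma matrix_diff_rdistrib: "A ** (B - C) = A ** B - A ** C"
  for A :: "real^'n^'m"
  by (simp add: vec_eq_iff matrix_matrix_mult_def right_diff_distrib sum_subtractf)

lemma matrix_mult_scaleR_right: "A ** (c *\<^sub>R B) = c *\<^sub>R (A ** B)"
  for A :: "real^'n^'m"
  by (simp add: vec_eq_iff matrix_matrix_mult_def sum_distrib_left mult_ac)

lemma matrix_mult_scaleR_left: "(c *\<^sub>R A) ** B = c *\<^sub>R (A ** B)"
  for A :: "real^'n^'m"
  by (simp add: vec_eq_iff matrix_matrix_mult_def sum_distrib_left mult_ac)

section \<open>The smallest eigenvalue\<close>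

lemma linear_le_quadratic_imp_zero:
  fixes b c :: real
  assumes "\<And>e. e * b \<le> e\<^sup>2 * c"
  shows "b = 0"
proof (rule ccontr)
  assume b: "b \<noteq> 0"
  \<comment> \<open>Any positive \<open>k\<close> above \<open>c\<close> works: taking
    \<open>e = b / k\<close> turns the hypothesis into \<open>k \<le> c\<close>.\<close>
  define k where "k = 2 * (\<bar>c\<bar> + 1)"
  have k: "k > 0" "c < k" by (auto simp: k_def)
  have "b / k * b \<le> (b / k)\<^sup>2 * c" by (rule assms)
  then have "b\<^sup>2 * k \<le> b\<^sup>2 * c"
    using k by (simp add: field_simps power2_eq_square)
  then show False using b k by simp
qed

text \<open>The vector \<open>x\<close> minimizes the quadratic form, so the derivative there in the
  direction \<open>B *v x\<close>, which is twice the squared norm of \<open>B *v x\<close>, must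
  vanish.\<close>

lemma psd_kernel:
  fixes B :: "real^'n^'n"
  assumes sym: "transpose B = B" and psd: "\<And>x. 0 \<le> x \<bullet> (B *v x)" and x: "x \<bullet> (B *v x) = 0"
  shows "B *v x = 0"
proof -
  define y where "y = B *v x"
  have sw: "x \<bullet> (B *v y) = y \<bullet> y"
    by (metis inner_matrix_vector_mult sym y_def)
  have "e * (- 2 * (y \<bullet> y)) \<le> e\<^sup>2 * (y \<bullet> (B *v y))" for e
  proof -
    have "0 \<le> (x + e *\<^sub>R y) \<bullet> (B *v (x + e *\<^sub>R y))" by (rule psd)
    also have "\<dots> = 2 * e * (y \<bullet> y) + e\<^sup>2 * (y \<bullet> (B *v y))"
      using x sw
      by (simp add: matrix_vector_right_distrib matrix_vector_mult_scaleR inner_add_left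
          inner_add_right power2_eq_square distrib_left mult.assoc flip: y_def)
    finally show ?thesis by simp
  qed
  then have "- 2 * (y \<bullet> y) = 0" by (rule linear_le_quadratic_imp_zero)
  then show ?thesis by (simp add: y_def)
qed

text \<open>Needed because \<open>lambda_min\<close> is a \<open>Min\<close>, which is meaningful
  only on finite sets. Eigenvectors of a symmetric matrix for distinct eigenvalues are orthogonal,
  and an orthogonal family in finite dimension is finite.\<close>

lemma finite_eigenvalues:
  fixes A :: "real^'n^'n"
  assumes sym: "transpose A = A"
  shows "finite (eigenvalues A)"
proof -
  obtain v where v: "\<And>c. c \<in> eigenvalues A \<Longrightarrow> v c \<noteq> 0 \<and> A *v v c = c *\<^sub>R v c"
    using bchoice[of "eigenvalues A" "\<lambda>c x. x \<noteq> 0 \<and> A *v x = c *\<^sub>R x"]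
    by (auto simp: eigenvalues_def)
  have orth: "v c \<bullet> v d = 0" if "c \<in> eigenvalues A" "d \<in> eigenvalues A" "c \<noteq> d" for c d
  proof -
    have "v c \<bullet> (A *v v d) = (A *v v c) \<bullet> v d"
      by (metis inner_matrix_vector_mult sym)
    then have "d * (v c \<bullet> v d) = c * (v c \<bullet> v d)"
      using v that by simp
    then show ?thesis using that by simp
  qed
  have "inj_on v (eigenvalues A)"
    using orth v by (metis inj_onI inner_eq_zero_iff)
  moreover have "finite (v ` eigenvalues A)"
    by (rule pairwise_orthogonal_imp_finite) (auto simp: pairwise_def orthogonal_def intro!: orth)
  ultimately show ?thesis by (simp add: finite_image_iff)
qed

text \<open>The Rayleigh quotient attains its minimum \<open>m\<close> on the unit sphere at some
  \<open>z\<close>. Subtracting \<open>m\<close> times the identity leaves a positive semidefinite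
  matrix whose form vanishes at \<open>z\<close>, so \<open>psd_kernel\<close> makes
  \<open>m\<close> an eigenvalue.\<close>

lemma lambda_min_le:
  fixes A :: "real^'n^'n"
  assumes sym: "transpose A = A"
  shows "lambda_min A * (x \<bullet> x) \<le> x \<bullet> (A *v x)"
proof -
  have "continuous_on (sphere 0 1) (\<lambda>x. x \<bullet> (A *v x))"
    by (intro continuous_intros)
  moreover have "sphere 0 1 \<noteq> ({} :: (real^'n) set)"
    by simp
  ultimately obtain z where z: "norm z = 1" "\<And>y. norm y = 1 \<Longrightarrow> z \<bullet> (A *v z) \<le> y \<bullet> (A *v y)"
    using continuous_attains_inf[of "sphere (0::real^'n) 1" "\<lambda>x. x \<bullet> (A *v x)"] by auto
  define m where "m = z \<bullet> (A *v z)"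
  have ray: "m * (y \<bullet> y) \<le> y \<bullet> (A *v y)" for y
  proof (cases "y = 0")
    case False
    define w where "w = (1 / norm y) *\<^sub>R y"
    have "m \<le> w \<bullet> (A *v w)"
      unfolding m_def using False by (intro z) (simp add: w_def)
    also have "\<dots> = y \<bullet> (A *v y) / (y \<bullet> y)"
      by (simp add: w_def matrix_vector_mult_scaleR dot_square_norm power2_eq_square)
    finally show ?thesis using False by (simp add: field_simps)
  qed simp
  define B where "B = A - m *\<^sub>R mat 1"
  have Bv: "B *v y = A *v y - m *\<^sub>R y" for y
    by (simp add: B_def matrix_vector_mult_diff_rdistrib scaleR_matrix_vector_assoc[symmetric])
  have "transpose B = B"
    using sym by (auto simp: B_def vec_eq_iff transpose_def mat_def)
  moreover have "0 \<le> y \<bullet> (B *v y)" for y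
    using ray[of y] by (simp add: Bv inner_diff_right)
  moreover have "z \<bullet> (B *v z) = 0"
    using z(1) by (simp add: Bv inner_diff_right m_def dot_square_norm)
  ultimately have "B *v z = 0" by (rule psd_kernel)
  then have "m \<in> eigenvalues A"
    using z(1) unfolding eigenvalues_def by (auto simp: Bv intro!: exI[of _ z])
  then have "lambda_min A \<le> m"
    unfolding lambda_min_def by (intro Min_le finite_eigenvalues sym)
  then have "lambda_min A * (x \<bullet> x) \<le> m * (x \<bullet> x)"
    by (intro mult_right_mono) auto
  with ray[of x] show ?thesis by linarith
qed

section \<open>Maximizing a linear functional over orthogonal matrices\<close>

definition outer :: "real^'m \<Rightarrow> real^'n \<Rightarrow> real^'n^'m" where
  "outer u v = (\<chi> i j. u $ i * v $ j)"

lemma inner_outer: "S \<bullet> outer u v = u \<bullet> (S *v v)"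
  by (simp add: inner_matrix inner_vec_def[of u] outer_def matrix_vector_mult_def
      sum_distrib_left mult_ac)

lemma outer_mult_outer: "outer a b ** outer c d = (b \<bullet> c) *\<^sub>R outer a d"
  by (simp add: vec_eq_iff outer_def matrix_matrix_mult_def inner_vec_def sum_distrib_left
      sum_distrib_right mult_ac)

text \<open>Products of two reflections give plane rotations by rational formulas, without
  trigonometric functions.\<close>

definition householder :: "real^'n \<Rightarrow> real^'n^'n" where
  "householder w = mat 1 - (2 / (w \<bullet> w)) *\<^sub>R outer w w"

lemma householder_mult:
  "householder v ** householder w = mat 1 - (2 / (v \<bullet> v)) *\<^sub>R outer v v
     - (2 / (w \<bullet> w)) *\<^sub>R outer w w
     + (4 * (v \<bullet> w) / ((v \<bullet> v) * (w \<bullet> w))) *\<^sub>R outer v w"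
  by (simp add: householder_def matrix_diff_rdistrib diff_mult_distrib_matrix
      matrix_mult_scaleR_left matrix_mult_scaleR_right outer_mult_outer algebra_simps)

lemma orthogonal_householder:
  assumes "w \<noteq> 0"
  shows "orthogonal_matrix (householder w)"
proof -
  have "transpose (householder w) = householder w"
    by (auto simp: vec_eq_iff householder_def transpose_def outer_def mat_def)
  moreover have "householder w ** householder w = mat 1"
  proof -
    have "4 * (w \<bullet> w) / ((w \<bullet> w) * (w \<bullet> w)) = 2 / (w \<bullet> w) + 2 / (w \<bullet> w)"
      using assms by simp
    moreover have "A - X - X + (X + X) = A" for A X :: "real^'n^'n" by simp
    ultimately show ?thesis by (simp only: householder_mult scaleR_add_left)
  qed
  ultimately show ?thesis by (simp add: orthogonal_matrix_def)
qed

text \<open>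
  First-order condition at the identity, along the rotations that are products of the reflection
  in a basis vector and the reflection in a small perturbation of it.
\<close>

lemma maximal_imp_symmetric:
  fixes S :: "real^'n^'n"
  assumes max: "\<And>P. orthogonal_matrix P \<Longrightarrow> S \<bullet> P \<le> S \<bullet> mat 1"
  shows "transpose S = S"
proof -
  have "S $ i $ j = S $ j $ i" if ij: "i \<noteq> j" for i j
  proof -
    define a b where "a = (axis i 1 :: real^'n)" and "b = (axis j 1 :: real^'n)"
    have ab: "a \<bullet> a = 1" "b \<bullet> b = 1" "a \<bullet> b = 0" "b \<bullet> a = 0"
      using ij by (auto simp: a_def b_def inner_axis_axis)
    have "e * (a \<bullet> (S *v b) - b \<bullet> (S *v a)) \<le> e\<^sup>2 * (a \<bullet> (S *v a) + b \<bullet> (S *v b))" for e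
    proof -
      \<comment> \<open>At \<open>e = 0\<close> the vector \<open>w\<close> equals \<open>b\<close>
        and the two reflections cancel, so the rotation passes through the identity. The term of
        first order in \<open>e\<close> is the antisymmetric part of \<open>S\<close> at
        \<open>a\<close>, \<open>b\<close>.\<close>
      define w where "w = e *\<^sub>R a + b"
      define k where "k = 1 + e\<^sup>2"
      have k: "k > 0" by (simp add: k_def add_pos_nonneg)
      have ww: "w \<bullet> w = k" "w \<bullet> b = 1"
        using ab by (auto simp: w_def k_def inner_add_left inner_add_right power2_eq_square)
      have "w \<noteq> 0" "b \<noteq> 0" using ww by auto
      then have "S \<bullet> (householder w ** householder b) \<le> S \<bullet> mat 1"
        by (intro max orthogonal_matrix_mul orthogonal_householder)
      then have "- (2 / k) * (w \<bullet> (S *v w)) - 2 * (b \<bullet> (S *v b)) + 4 / k * (w \<bullet> (S *v b)) \<le> 0"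
        by (simp add: householder_mult inner_diff_right inner_add_right inner_outer ww ab)
      then have "- (w \<bullet> (S *v w)) - k * (b \<bullet> (S *v b)) + 2 * (w \<bullet> (S *v b)) \<le> 0"
        using k by (simp add: field_simps)
      then show ?thesis
        by (simp add: w_def k_def matrix_vector_right_distrib matrix_vector_mult_scaleR
            inner_add_left inner_add_right algebra_simps power2_eq_square)
    qed
    then have "a \<bullet> (S *v b) - b \<bullet> (S *v a) = 0" by (rule linear_le_quadratic_imp_zero)
    then show ?thesis
      by (simp add: a_def b_def inner_axis' matrix_vector_mul_component inner_axis)
  qed
  then show ?thesis by (auto simp: vec_eq_iff transpose_def) metis
qed

text \<open>The inner product of \<open>transpose D ** D\<close> with \<open>S\<close> is computed
  twice. Orthogonality of \<open>Q\<close> and the equality of values make it zero; row by row it is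
  a sum of values of the positive definite form, so every row of \<open>D\<close> vanishes.\<close>

lemma pos_def_maximizer_unique:
  fixes S :: "real^'n^'n"
  assumes S: "pos_def S" and Q: "orthogonal_matrix Q" and eq: "S \<bullet> Q = S \<bullet> mat 1"
  shows "Q = mat 1"
proof -
  define D where "D = mat 1 - Q"
  have sym: "transpose S = S" using S by (simp add: pos_def_def)
  have tQ: "S \<bullet> transpose Q = S \<bullet> Q"
    using inner_transpose[of S Q] by (simp add: sym)
  have DD: "transpose D ** D = mat 1 + mat 1 - Q - transpose Q"
    using Q by (simp add: D_def transpose_diff matrix_diff_rdistrib diff_mult_distrib_matrix
        orthogonal_matrix_def)
  have "(\<Sum>i\<in>UNIV. D $ i \<bullet> (S *v D $ i)) = D \<bullet> (D ** S)"
  proof -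
    have "(D ** S) $ i = S *v D $ i" for i
      by (subst (2) sym[symmetric])
        (simp add: vec_eq_iff matrix_matrix_mult_def vector_matrix_mult_def mult.commute)
    then show ?thesis by (simp add: inner_vec_def[of D])
  qed
  also have "\<dots> = (transpose D ** D) \<bullet> S"
    using inner_matrix_mult_left[of D S D] by (simp add: inner_commute)
  also have "\<dots> = 0"
    using eq tQ unfolding DD inner_commute[of _ S] inner_diff_right inner_add_right by simp
  finally have sum0: "(\<Sum>i\<in>UNIV. D $ i \<bullet> (S *v D $ i)) = 0" .
  have pos: "0 \<le> x \<bullet> (S *v x)" for x
    using S by (cases "x = 0") (auto simp: pos_def_def less_imp_le)
  have "D $ i \<bullet> (S *v D $ i) = 0" for i
    using sum0 by (subst (asm) sum_nonneg_eq_0_iff) (auto simp: pos)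
  then have "D $ i = 0" for i
    using S by (metis less_irrefl pos_def_def)
  then show ?thesis by (simp add: D_def vec_eq_iff)
qed

section \<open>Uniqueness of the closest representative\<close>

text \<open>Maximizing a linear functional over \<open>block_orth\<close> thus decouples into one
  problem per time index.\<close>

lemma inner_block_diag: "K \<bullet> block_diag B = (\<Sum>t\<in>UNIV. block K t t \<bullet> B t)"
  for K :: "('t::finite, 'd::finite) block_matrix"
proof -
  have "K \<bullet> block_diag B = (\<Sum>s\<in>UNIV. \<Sum>i\<in>UNIV. \<Sum>t\<in>UNIV. \<Sum>j\<in>UNIV.
      K $ (s, i) $ (t, j) * (if s = t then B s $ i $ j else 0))"
    by (simp add: inner_matrix sum_prod_UNIV block_diag_def cong: if_cong)
  also have "\<dots> = (\<Sum>s\<in>UNIV. \<Sum>i\<in>UNIV. \<Sum>t\<in>UNIV. if t = s then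
      \<Sum>j\<in>UNIV. K $ (s, i) $ (s, j) * B s $ i $ j else 0)"
    by (intro sum.cong refl) auto
  also have "\<dots> = (\<Sum>t\<in>UNIV. block K t t \<bullet> B t)"
    by (simp add: inner_matrix block_def)
  finally show ?thesis .
qed

text \<open>Isometric embedding of the \<open>t\<close>-th coordinate block; it reads quadratic
  forms of diagonal blocks as quadratic forms of the whole matrix.\<close>

definition block_vec :: "'t::finite \<Rightarrow> real^'d::finite \<Rightarrow> real^('t \<times> 'd)" where
  "block_vec t x = (\<chi> p. if fst p = t then x $ snd p else 0)"

lemma inner_block_vec: "block_vec t x \<bullet> block_vec t y = x \<bullet> y"
proof -
  have "block_vec t x \<bullet> block_vec t y =
      (\<Sum>s\<in>UNIV. if s = t then \<Sum>i\<in>UNIV. x $ i * y $ i else 0)"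
    unfolding inner_vec_def sum_prod_UNIV by (intro sum.cong) (auto simp: block_vec_def)
  then show ?thesis by (simp add: inner_vec_def)
qed

lemma block_vec_quadratic:
  "block_vec t x \<bullet> (A *v block_vec t y) = x \<bullet> (block A t t *v y)"
proof -
  have 1: "(A *v block_vec t y) $ (t, i) = (block A t t *v y) $ i" for i
  proof -
    have "(A *v block_vec t y) $ (t, i) =
        (\<Sum>s\<in>UNIV. if s = t then \<Sum>j\<in>UNIV. A $ (t, i) $ (t, j) * y $ j else 0)"
      unfolding matrix_vector_mult_def vec_lambda_beta sum_prod_UNIV
      by (intro sum.cong) (auto simp: block_vec_def)
    then show ?thesis by (simp add: matrix_vector_mult_def block_def)
  qed
  have "block_vec t x \<bullet> (A *v block_vec t y) =
      (\<Sum>s\<in>UNIV. if s = t then \<Sum>i\<in>UNIV. x $ i * (A *v block_vec t y) $ (t, i) else 0)"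
    unfolding inner_vec_def sum_prod_UNIV by (intro sum.cong) (auto simp: block_vec_def)
  then show ?thesis by (simp add: inner_vec_def 1)
qed

text \<open>Since \<open>norm (M ** Q)\<close> does not depend on \<open>Q\<close>, only the cross
  term varies: minimizing the distance is maximizing a linear functional.\<close>

lemma norm_diff_mult_orthogonal:
  fixes L M :: "real^'n^'n"
  assumes "orthogonal_matrix Q"
  shows "(norm (L - M ** Q))\<^sup>2 = (norm L)\<^sup>2 + (norm M)\<^sup>2 - 2 * ((transpose M ** L) \<bullet> Q)"
proof -
  have "(M ** Q) \<bullet> L = (transpose M ** L) \<bullet> Q"
    by (metis inner_matrix_mult_left inner_commute)
  moreover have "(norm (L - M ** Q))\<^sup>2 = (norm L)\<^sup>2 + (norm (M ** Q))\<^sup>2 - 2 * ((M ** Q) \<bullet> L)"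
    by (simp add: power2_norm_eq_inner inner_diff_left inner_diff_right inner_commute)
  ultimately show ?thesis
    by (simp add: norm_mult_orthogonal[OF assms])
qed

text \<open>Compare with the competitor that is \<open>P\<close> in block \<open>t\<close> and the
  identity in all others; every other block contributes equally to both sides.\<close>

lemma closest_representative_block:
  fixes L M :: "('t::{finite,linorder}, 'd::finite) block_matrix"
  assumes close: "\<And>Q. Q \<in> block_orth \<Longrightarrow> norm (L - M) \<le> norm (L - M ** Q)"
    and P: "orthogonal_matrix P"
  shows "block (transpose M ** L) t t \<bullet> P \<le> block (transpose M ** L) t t \<bullet> mat 1"
proof -
  let ?B = "(\<lambda>s. mat 1)(t := P)"
  have B: "block_diag ?B \<in> block_orth"
    using P unfolding block_orth_def by (auto simp: orthogonal_matrix_id intro!: exI[of _ ?B])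
  have "(norm (L - M ** mat 1))\<^sup>2 \<le> (norm (L - M ** block_diag ?B))\<^sup>2"
    using close[OF B] by (intro power_mono) auto
  then have "(transpose M ** L) \<bullet> block_diag ?B \<le> (transpose M ** L) \<bullet> block_diag (\<lambda>s. mat 1)"
    unfolding block_diag_mat_1 norm_diff_mult_orthogonal[OF orthogonal_matrix_id]
      norm_diff_mult_orthogonal[OF block_orth_orthogonal[OF B]] by simp
  then show ?thesis
    unfolding inner_block_diag by (simp add: sum.remove[of UNIV t])
qed

text \<open>On vectors \<open>z\<close> supported in block \<open>t\<close>, the eigenvalue bound
  makes \<open>(L - M) *v z\<close> strictly shorter than \<open>L *v z\<close>. Hence
  \<open>M *v z\<close> has positive inner product with \<open>L *v z\<close>, and that is the
  quadratic form of the block.\<close>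

lemma closest_representative_pos_def:
  fixes L M :: "('t::{finite,linorder}, 'd::finite) block_matrix"
  assumes close: "\<And>Q. Q \<in> block_orth \<Longrightarrow> norm (L - M) \<le> norm (L - M ** Q)"
    and eig: "\<And>t. (norm (L - M))\<^sup>2 < lambda_min (block (transpose L ** L) t t)"
  shows "pos_def (block (transpose M ** L) t t)"
proof -
  let ?S = "\<lambda>t. block (transpose M ** L) t t"
  have "transpose (?S t) = ?S t"
    by (intro maximal_imp_symmetric closest_representative_block close)
  moreover have "0 < x \<bullet> (?S t *v x)" if "x \<noteq> 0" for x
  proof -
    define z where "z = block_vec t x"
    have zz: "(norm z)\<^sup>2 = x \<bullet> x"
      unfolding power2_norm_eq_inner z_def by (rule inner_block_vec)
    define a where "a = L *v z"
    define b where "b = (L - M) *v z"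
    have symL: "transpose (block (transpose L ** L) t t) = block (transpose L ** L) t t"
      by (simp add: vec_eq_iff transpose_def block_def matrix_matrix_mult_def mult.commute)
    have "(norm b)\<^sup>2 \<le> (norm (L - M))\<^sup>2 * (norm z)\<^sup>2"
      unfolding b_def power_mult_distrib[symmetric]
      by (intro power_mono norm_matrix_vector_mult_le) simp
    also have "\<dots> < lambda_min (block (transpose L ** L) t t) * (x \<bullet> x)"
      unfolding zz using that by (intro mult_strict_right_mono eig) simp
    also have "\<dots> \<le> x \<bullet> (block (transpose L ** L) t t *v x)"
      by (rule lambda_min_le[OF symL])
    also have "\<dots> = z \<bullet> (transpose L *v (L *v z))"
      by (simp add: z_def flip: block_vec_quadratic matrix_vector_mul_assoc)
    also have "\<dots> = (norm a)\<^sup>2"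
      by (simp only: inner_matrix_vector_mult[of z] transpose_transpose a_def power2_norm_eq_inner)
    finally have ba: "norm b < norm a"
      by (rule power2_less_imp_less) simp
    \<comment> \<open>Here \<open>M *v z\<close> is \<open>a - b\<close>, and Cauchy-Schwarz bounds
      its inner product with \<open>a\<close> from below by this difference.\<close>
    have "0 < norm a * norm a - norm a * norm b"
      using ba le_less_trans[OF norm_ge_zero ba] by (simp flip: right_diff_distrib)
    also have "\<dots> \<le> a \<bullet> a - b \<bullet> a"
      using norm_cauchy_schwarz[of b a]
      by (simp add: dot_square_norm power2_eq_square mult.commute)
    also have "\<dots> = (M *v z) \<bullet> a"
      by (simp add: a_def b_def matrix_vector_mult_diff_rdistrib inner_diff_left)
    also have "\<dots> = z \<bullet> (transpose M *v (L *v z))"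
      by (simp only: inner_matrix_vector_mult[of z] transpose_transpose a_def)
    also have "\<dots> = x \<bullet> (?S t *v x)"
      by (simp add: z_def flip: block_vec_quadratic matrix_vector_mul_assoc)
    finally show ?thesis .
  qed
  ultimately show ?thesis by (simp add: pos_def_def)
qed

text \<open>Each block of \<open>P\<close> has a nonnegative deficit against the identity, and the
  deficits sum to at most zero. So every block attains the maximum, which positive definiteness
  allows only at the identity.\<close>

lemma closest_representative_unique:
  fixes L M :: "('t::{finite,linorder}, 'd::finite) block_matrix"
  assumes close: "\<And>Q. Q \<in> block_orth \<Longrightarrow> norm (L - M) \<le> norm (L - M ** Q)"
    and eig: "\<And>t. (norm (L - M))\<^sup>2 < lambda_min (block (transpose L ** L) t t)"
    and P: "P \<in> block_orth" "norm (L - M ** P) \<le> norm (L - M)"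
  shows "M ** P = M"
proof -
  let ?K = "transpose M ** L"
  note pd = closest_representative_pos_def[OF close eig]
  obtain B where B: "P = block_diag B" "\<And>t. orthogonal_matrix (B t)"
    using P(1) by (auto simp: block_orth_def)
  have "(norm (L - M ** P))\<^sup>2 \<le> (norm (L - M ** mat 1))\<^sup>2"
    using P(2) by (intro power_mono) auto
  then have "?K \<bullet> block_diag (\<lambda>t. mat 1) \<le> ?K \<bullet> block_diag B"
    unfolding block_diag_mat_1 B(1)[symmetric] norm_diff_mult_orthogonal[OF orthogonal_matrix_id]
      norm_diff_mult_orthogonal[OF block_orth_orthogonal[OF P(1)]] by simp
  then have sum_le: "(\<Sum>t\<in>UNIV. block ?K t t \<bullet> mat 1 - block ?K t t \<bullet> B t) \<le> 0"
    unfolding inner_block_diag by (simp add: sum_subtractf)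
  have nonneg: "0 \<le> block ?K t t \<bullet> mat 1 - block ?K t t \<bullet> B t" for t
    using closest_representative_block[OF close B(2)] by simp
  have "(\<Sum>t\<in>UNIV. block ?K t t \<bullet> mat 1 - block ?K t t \<bullet> B t) = 0"
    using sum_le by (intro antisym sum_nonneg nonneg)
  then have "block ?K t t \<bullet> B t = block ?K t t \<bullet> mat 1" for t
    by (subst (asm) sum_nonneg_eq_0_iff) (use nonneg in auto)
  then have "B t = mat 1" for t
    using pos_def_maximizer_unique[OF pd B(2)] by blast
  then have "B = (\<lambda>t. mat 1)" by blast
  then have "P = mat 1" by (simp add: B(1) block_diag_mat_1)
  then show ?thesis by simp
qed

section \<open>Geodesics\<close>

lemma d_ABW_le:
  assumes "Q \<in> block_orth"
  shows "d_ABW L M \<le> norm (L - M ** Q)"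
  using d_ABW_attained[of L M] assms by metis

lemma d_ABW_le_norm: "d_ABW L M \<le> norm (L - M)"
  using d_ABW_le[OF mat_1_in_block_orth] by simp

lemma orth_rel_mult:
  assumes "L \<in> block_lower" "Q \<in> block_orth"
  shows "(L ** Q, L) \<in> orth_rel"
  using assms block_lower_mult_orth by (auto simp: orth_rel_def)

lemma orth_class_mult:
  assumes "L \<in> block_lower" "Q \<in> block_orth"
  shows "orth_class (L ** Q) = orth_class L"
  unfolding orth_class_def by (rule equiv_class_eq[OF equiv_orth_rel orth_rel_mult[OF assms]])

text \<open>Multiplying by the transpose of an optimal \<open>Q\<close> preserves the norm and moves
  the orthogonal factor from \<open>M\<close> to \<open>L\<close>.\<close>

lemma d_ABW_commute: "d_ABW L M = d_ABW M L"
proof -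
  have "d_ABW M L \<le> d_ABW L M" for L M :: "('t::{finite,linorder}, 'd::finite) block_matrix"
  proof -
    obtain Q where Q: "Q \<in> block_orth" "d_ABW L M = norm (L - M ** Q)"
      using d_ABW_attained by blast
    have "Q ** transpose Q = mat 1"
      using block_orth_orthogonal[OF Q(1)] by (simp add: orthogonal_matrix_def)
    then have "(L - M ** Q) ** transpose Q = L ** transpose Q - M"
      by (simp add: diff_mult_distrib_matrix matrix_mul_assoc[symmetric])
    then have "norm (L ** transpose Q - M) = d_ABW L M"
      using Q norm_mult_orthogonal block_orth_orthogonal block_orth_transpose by metis
    then show ?thesis
      using d_ABW_le[OF block_orth_transpose[OF Q(1)], of M L] by (simp add: norm_minus_commute)
  qed
  then show ?thesis by (intro antisym)
qed

text \<open>Optimal alignments compose: \<open>R ** Q\<close> is an admissible alignment of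
  \<open>N\<close> with \<open>L\<close>.\<close>

lemma d_ABW_triangle:
  fixes L M N :: "('t::{finite,linorder}, 'd::finite) block_matrix"
  shows "d_ABW L N \<le> d_ABW L M + d_ABW M N"
proof -
  obtain Q where Q: "Q \<in> block_orth" "d_ABW L M = norm (L - M ** Q)"
    using d_ABW_attained by blast
  obtain R where R: "R \<in> block_orth" "d_ABW M N = norm (M - N ** R)"
    using d_ABW_attained by blast
  have "d_ABW L N \<le> norm (L - N ** (R ** Q))"
    by (intro d_ABW_le block_orth_mult Q R)
  also have "L - N ** (R ** Q) = (L - M ** Q) + (M - N ** R) ** Q"
    by (simp add: diff_mult_distrib_matrix matrix_mul_assoc)
  also have "norm \<dots> \<le> norm (L - M ** Q) + norm ((M - N ** R) ** Q)"
    by (rule norm_triangle_ineq)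
  also have "\<dots> = d_ABW L M + d_ABW M N"
    using Q R by (simp add: norm_mult_orthogonal block_orth_orthogonal)
  finally show ?thesis .
qed

section \<open>Straight segments and their classes\<close>

lemma block_lower_segment:
  assumes "L \<in> block_lower" "M \<in> block_lower"
  shows "(1 - u) *\<^sub>R L + u *\<^sub>R M \<in> block_lower"
  using assms by (simp add: block_lower_def block_def vec_eq_iff)

lemma lower_quotE:
  assumes "X \<in> lower_quot"
  obtains N where "N \<in> block_lower" "X = orth_class N"
  using assms unfolding lower_quot_def orth_class_def by (auto elim: quotientE)

lemma orth_class_in_lower_quot: "N \<in> block_lower \<Longrightarrow> orth_class N \<in> lower_quot"
  unfolding lower_quot_def orth_class_def by (rule quotientI)

lemma segment_geodesic:
  fixes L M :: "('t::{finite,linorder}, 'd::finite) block_matrix"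
  assumes LM: "L \<in> block_lower" "M \<in> block_lower" and close: "d_ABW L M = norm (L - M)"
  shows "const_speed_geodesic lower_quot quot_d_ABW (orth_class L) (orth_class M)
    (\<lambda>u\<in>{0..1}. orth_class ((1 - u) *\<^sub>R L + u *\<^sub>R M))"
proof -
  define c where "c u = (1 - u) *\<^sub>R L + u *\<^sub>R M" for u
  have cl: "c u \<in> block_lower" for u
    unfolding c_def by (rule block_lower_segment[OF LM])
  have c01: "c 0 = L" "c 1 = M" by (auto simp: c_def)
  have le: "d_ABW (c u) (c v) \<le> \<bar>u - v\<bar> * d_ABW L M" for u v
  proof -
    have "c u - c v = (v - u) *\<^sub>R (L - M)"
      by (simp add: c_def algebra_simps)
    then show ?thesis
      using d_ABW_le_norm[of "c u" "c v"] by (simp add: close abs_minus_commute)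
  qed
  have eq: "d_ABW (c u) (c v) = \<bar>u - v\<bar> * d_ABW L M" if "0 \<le> u" "u \<le> v" "v \<le> 1" for u v
  proof (rule antisym[OF le])
    \<comment> \<open>The outer pieces have at most their proportional lengths, so the middle piece
      cannot be shorter than its share.\<close>
    have "d_ABW L M \<le> d_ABW (c 0) (c u) + d_ABW (c u) (c v) + d_ABW (c v) (c 1)"
      using d_ABW_triangle[of "c 0" "c 1" "c u"] d_ABW_triangle[of "c u" "c 1" "c v"]
      by (simp add: c01)
    also have "\<dots> \<le> u * d_ABW L M + d_ABW (c u) (c v) + (1 - v) * d_ABW L M"
      using le[of 0 u] le[of v 1] that by simp
    finally show "\<bar>u - v\<bar> * d_ABW L M \<le> d_ABW (c u) (c v)"
      using that by (simp add: algebra_simps)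
  qed
  have "d_ABW (c u) (c v) = \<bar>u - v\<bar> * d_ABW L M" if "u \<in> {0..1}" "v \<in> {0..1}" for u v
  proof (cases "u \<le> v")
    case False
    then show ?thesis
      using eq[of v u] that by (simp add: d_ABW_commute[of "c u"] abs_minus_commute)
  qed (use eq that in auto)
  then show ?thesis
    using c01 unfolding const_speed_geodesic_def c_def[symmetric]
    by (auto simp: quot_d_ABW_orth_class cl LM orth_class_in_lower_quot)
qed

text \<open>Equality case of the triangle inequality, from Stewart's identity for the distance of
  \<open>z\<close> to a point of the line through \<open>x\<close> and \<open>y\<close>.\<close>

lemma between_eq_convex_combination:
  fixes x y z :: "'a::real_inner"
  assumes "norm (x - z) = u * d" "norm (z - y) = (1 - u) * d" "norm (x - y) = d"
  shows "z = (1 - u) *\<^sub>R x + u *\<^sub>R y"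
proof -
  have "(norm (z - ((1 - u) *\<^sub>R x + u *\<^sub>R y)))\<^sup>2
      = (1 - u) * (norm (x - z))\<^sup>2 + u * (norm (z - y))\<^sup>2 - u * (1 - u) * (norm (x - y))\<^sup>2"
    by (simp add: power2_norm_eq_inner inner_diff_left inner_diff_right inner_add_left
        inner_add_right inner_commute algebra_simps)
  also have "\<dots> = 0"
    unfolding assms by (simp add: algebra_simps power2_eq_square)
  finally show ?thesis by simp
qed

text \<open>Align a representative \<open>N\<close> of the point with \<open>L\<close>, then
  \<open>M\<close> with \<open>N\<close>. The two distances add up to \<open>d_ABW L M\<close>, so
  \<open>M ** Q\<close> is also closest to \<open>L\<close> and \<open>N\<close> lies on the segment
  joining them. At this stage \<open>Q\<close> may vary with \<open>u\<close>.\<close>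

lemma geodesic_point:
  fixes L M :: "('t::{finite,linorder}, 'd::finite) block_matrix"
  assumes LM: "L \<in> block_lower" "M \<in> block_lower"
    and geo: "const_speed_geodesic lower_quot quot_d_ABW (orth_class L) (orth_class M) \<gamma>"
    and u: "u \<in> {0..1}"
  obtains Q where "Q \<in> block_orth" "norm (L - M ** Q) = d_ABW L M"
    "\<gamma> u = orth_class ((1 - u) *\<^sub>R L + u *\<^sub>R (M ** Q))"
proof -
  have "\<gamma> u \<in> lower_quot"
    using geo u by (auto simp: const_speed_geodesic_def)
  then obtain N' where N': "N' \<in> block_lower" "\<gamma> u = orth_class N'" by (rule lower_quotE)
  obtain P where P: "P \<in> block_orth" "d_ABW L N' = norm (L - N' ** P)"
    using d_ABW_attained by blast
  define N where "N = N' ** P"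
  have N: "N \<in> block_lower" "\<gamma> u = orth_class N"
    using N' P by (auto simp: N_def orth_class_mult block_lower_mult_orth)
  have geo': "quot_d_ABW (\<gamma> v) (\<gamma> w) = \<bar>v - w\<bar> * d_ABW L M" if "v \<in> {0..1}" "w \<in> {0..1}" for v w
    using geo that LM by (simp add: const_speed_geodesic_def quot_d_ABW_orth_class)
  have \<gamma>01: "\<gamma> 0 = orth_class L" "\<gamma> 1 = orth_class M"
    using geo by (auto simp: const_speed_geodesic_def)
  have LN: "norm (L - N) = u * d_ABW L M"
    using geo'[of 0 u] u P LM N' by (simp add: \<gamma>01 quot_d_ABW_orth_class N_def)
  obtain Q where Q: "Q \<in> block_orth" "d_ABW N M = norm (N - M ** Q)"
    using d_ABW_attained by blast
  have NM: "norm (N - M ** Q) = (1 - u) * d_ABW L M"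
    using geo'[of u 1] u Q LM N by (simp add: \<gamma>01 quot_d_ABW_orth_class)
  have "norm (L - M ** Q) \<le> norm (L - N) + norm (N - M ** Q)"
    using norm_triangle_ineq[of "L - N" "N - M ** Q"] by simp
  also have "\<dots> = d_ABW L M"
    by (simp add: LN NM algebra_simps)
  finally have eq: "norm (L - M ** Q) = d_ABW L M"
    using d_ABW_le[OF Q(1), of L M] by simp
  show ?thesis
    using between_eq_convex_combination[OF LN NM eq] N(2) by (intro that[OF Q(1) eq]) simp
qed

theorem corollary1p10:
  fixes L M :: "('t::{finite,linorder}, 'd::finite) block_matrix"
  assumes "L \<in> block_lower_reg" and "M \<in> block_lower"
    and "(quot_d_ABW (orth_class L) (orth_class M))\<^sup>2
           < (MIN t\<in>UNIV. lambda_min (block (transpose L ** L) t t))"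
  shows "\<exists>!\<gamma>. const_speed_geodesic lower_quot quot_d_ABW (orth_class L) (orth_class M) \<gamma>"
proof -
  have L: "L \<in> block_lower" using assms(1) by (simp add: block_lower_reg_def)
  obtain Q where Q: "Q \<in> block_orth" "d_ABW L M = norm (L - M ** Q)"
    using d_ABW_attained by blast
  \<comment> \<open>Passing to a closest representative leaves the class, hence the hypothesis and
    the claim, unchanged.\<close>
  define M' where "M' = M ** Q"
  have M': "M' \<in> block_lower" "orth_class M' = orth_class M"
    using assms(2) Q(1) by (auto simp: M'_def block_lower_mult_orth orth_class_mult)
  have d: "d_ABW L M' = norm (L - M')"
    using quot_d_ABW_orth_class[OF L M'(1)] quot_d_ABW_orth_class[OF L assms(2)] Q
    by (simp add: M'(2) flip: M'_def)
  have close: "norm (L - M') \<le> norm (L - M' ** P)" if "P \<in> block_orth" for P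
    using d_ABW_le[OF that, of L M'] d by simp
  have eig: "(norm (L - M'))\<^sup>2 < lambda_min (block (transpose L ** L) t t)" for t
  proof -
    have "(norm (L - M'))\<^sup>2 < (MIN t\<in>UNIV. lambda_min (block (transpose L ** L) t t))"
      using assms(3) quot_d_ABW_orth_class[OF L M'(1)] by (simp add: M'(2) d)
    also have "\<dots> \<le> lambda_min (block (transpose L ** L) t t)"
      by (intro Min_le) auto
    finally show ?thesis .
  qed
  let ?c = "\<lambda>u\<in>{0..1}. orth_class ((1 - u) *\<^sub>R L + u *\<^sub>R M')"
  have "\<gamma> = ?c"
    if geo: "const_speed_geodesic lower_quot quot_d_ABW (orth_class L) (orth_class M') \<gamma>" for \<gamma>
  proof (rule extensionalityI[of _ "{0..1}"])
    show "\<gamma> \<in> extensional {0..1}"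
      using geo by (auto simp: const_speed_geodesic_def PiE_def)
    fix u :: real assume u: "u \<in> {0..1}"
    obtain P where P: "P \<in> block_orth" "norm (L - M' ** P) = d_ABW L M'"
      "\<gamma> u = orth_class ((1 - u) *\<^sub>R L + u *\<^sub>R (M' ** P))"
      by (rule geodesic_point[OF L M'(1) geo u])
    \<comment> \<open>Uniqueness of the closest representative removes the dependence of the
      endpoint on \<open>u\<close>.\<close>
    have "M' ** P = M'"
      using P d by (intro closest_representative_unique[OF close eig]) auto
    then show "\<gamma> u = ?c u" using P u by simp
  qed simp
  then show ?thesis
    using segment_geodesic[OF L M'(1) d] by (auto simp: M'(2))
qed

end
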